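(* For every $\Theta=(\theta_1,\theta_2)\in\mathbb{R}^2$, the set $$\mathrm{BAD}^{\Theta}(2/3,1/3)=\Big\{(\eta_1,\eta_2)\in\mathbb{R}^2:\ \inf_{q\in\mathbb{Z}_+}\max\big(q^{2/3}\|q\theta_1-\eta_1\|,\ q^{1/3}\|q\theta_2-\eta_2\|\big)>0\Big\}$$ is non-empty. Moreover, it has full Hausdorff dimension, i.e. Hausdorff dimension $2$.
   Context: For a real number $x$, $\|x\|$ denotes the distance from $x$ to the nearest integer. $\mathbb{Z}_+$ denotes the set of positive integers. *)

theory Defs
  imports "HOL-Analysis.Analysis"
begin

definition dist_int :: "real \<Rightarrow> real" where
  "dist_int x = \<bar>x - of_int (round x)\<bar>"

lemma dist_int_eq_infdist: "dist_int x = infdist x \<int>"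
proof -
  have ne: "(\<int> :: real set) \<noteq> {}"
    using Ints_0 by blast
  have "infdist x \<int> \<le> dist x (of_int (round x))"
    by (rule infdist_le) auto
  moreover have "dist_int x \<le> infdist x \<int>"
    unfolding infdist_notempty[OF ne] dist_int_def
    by (rule cINF_greatest[OF ne]) (auto elim!: Ints_cases simp: dist_real_def round_diff_minimal)
  ultimately show ?thesis
    by (simp add: dist_int_def dist_real_def)
qed

definition BAD :: "real \<times> real \<Rightarrow> real \<Rightarrow> real \<Rightarrow> (real \<times> real) set" where
  "BAD \<Theta> i j = {(\<eta>\<^sub>1, \<eta>\<^sub>2).
     (INF q\<in>{q::nat. 0 < q}.
        max (real q powr i * dist_int (real q * fst \<Theta> - \<eta>\<^sub>1))
            (real q powr j * dist_int (real q * snd \<Theta> - \<eta>\<^sub>2))) > 0}"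

text \<open>
  The \<open>s\<close>-th power of the diameter, with the usual conventions \<open>0\<^sup>0 = 1\<close> for nonempty sets
  and value \<open>0\<close> for the empty set; note that \<^term>\<open>(0::real) powr 0 = 0\<close>.
\<close>
definition diam_powr :: "real \<Rightarrow> 'a::metric_space set \<Rightarrow> real" where
  "diam_powr s U = (if U = {} then 0 else if s = 0 then 1 else diameter U powr s)"

text \<open>
  Covering sets are required to be bounded because \<^const>\<open>diameter\<close> is real-valued and
  unspecified on unbounded sets. Since \<open>{}\<close> is an admissible covering set, finite covers
  are included.
\<close>
definition hausdorff_premeasure :: "real \<Rightarrow> real \<Rightarrow> 'a::metric_space set \<Rightarrow> ennreal" where
  "hausdorff_premeasure s \<delta> A =
     (INF U \<in> {U :: nat \<Rightarrow> 'a set.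
         (\<forall>n. bounded (U n) \<and> diameter (U n) \<le> \<delta>) \<and> A \<subseteq> (\<Union>n. U n)}.
       \<Sum>n. ennreal (diam_powr s (U n)))"

definition hausdorff_measure :: "real \<Rightarrow> 'a::metric_space set \<Rightarrow> ennreal" where
  "hausdorff_measure s A = (SUP \<delta>\<in>{0<..}. hausdorff_premeasure s \<delta> A)"

definition hausdorff_dim :: "'a::metric_space set \<Rightarrow> ennreal" where
  "hausdorff_dim A = (INF s\<in>{s. 0 \<le> s \<and> hausdorff_measure s A = 0}. ennreal s)"

end

theory Submission
  imports Defs
begin

text \<open>
  If \<open>(m\<^sub>1, m\<^sub>2)\<close> is an integer vector with \<open>\<bar>m\<^sub>1\<bar> \<le> Q\<^bsup>2/3\<^esup>\<close>, \<open>\<bar>m\<^sub>2\<bar> \<le> Q\<^bsup>1/3\<^esup>\<close> and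
  \<open>m\<^sub>1 \<theta>\<^sub>1 + m\<^sub>2 \<theta>\<^sub>2\<close> within \<open>1/Q\<close> of an integer (Dirichlet), then keeping \<open>m\<^sub>1 \<eta>\<^sub>1 + m\<^sub>2 \<eta>\<^sub>2\<close> away
  from the integers forces one of \<open>q \<theta>\<^sub>i - \<eta>\<^sub>i\<close> to stay away from the integers for all \<open>q\<close>
  comparable to \<open>Q\<close>. One such vector for each scale \<open>Q = X\<^bsup>3t\<^esup>\<close> suffices.
  Split a rectangle of size \<open>X\<^bsup>-2t\<^esup> \<times> X\<^bsup>-t\<^esup>\<close> into \<open>X\<^sup>3\<close> rectangles of the next scale; the
  vector of scale \<open>t\<close> spoils only \<open>O(X\<^sup>2)\<close> of them.

  Given a cover with \<open>\<Sum> diam\<^sup>s\<close> small and \<open>s < 2\<close>, the method of conditional expectations produces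
  a branch of unspoiled rectangles whose limit point also avoids every set of the cover: a set of
  diameter about \<open>X\<^bsup>-l\<^esup>\<close> meets \<open>O(X\<^sup>l)\<close> rectangles of scale \<open>l\<close>, so a random branch meets it with
  probability \<open>O(X\<^sup>l / X\<^bsup>(s+1)l\<^esup>) = O(diam\<^sup>s)\<close> as soon as \<open>X\<^sup>3 - O(X\<^sup>2) \<ge> X\<^bsup>s+1\<^esup>\<close>.
\<close>

section \<open>Integers near a point and the transference inequality\<close>

lemma card_int_near_le:
  fixes x r :: real
  assumes "0 \<le> r"
  shows "finite {i::int. \<bar>of_int i - x\<bar> \<le> r}"
    and "real (card {i::int. \<bar>of_int i - x\<bar> \<le> r}) \<le> 2 * r + 1"
proof -
  have eq: "{i::int. \<bar>of_int i - x\<bar> \<le> r} = {\<lceil>x - r\<rceil>..\<lfloor>x + r\<rfloor>}"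
    by (auto simp: abs_le_iff ceiling_le_iff le_floor_iff)
  show "finite {i::int. \<bar>of_int i - x\<bar> \<le> r}"
    by (simp add: eq)
  have "of_int \<lfloor>x + r\<rfloor> - of_int \<lceil>x - r\<rceil> \<le> 2 * r"
    by linarith
  then show "real (card {i::int. \<bar>of_int i - x\<bar> \<le> r}) \<le> 2 * r + 1"
    using assms unfolding eq by (cases "\<lceil>x - r\<rceil> \<le> \<lfloor>x + r\<rfloor>") auto
qed

lemma dist_int_le: "dist_int x \<le> \<bar>x - of_int k\<bar>"
  by (simp add: dist_int_def round_diff_minimal)

text \<open>Write m.y = q (m.x) - m1 (q x1 - y1) - m2 (q x2 - y2) and subtract the nearest integer
  from each bracket. So if m.y is far from the integers while q times the distance of m.x is small,
  some q xi - yi must be far from the integers.\<close>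

lemma dist_int_scaled_sum_le:
  fixes q :: nat and m\<^sub>1 m\<^sub>2 :: int
  shows "dist_int (of_int m\<^sub>1 * y\<^sub>1 + of_int m\<^sub>2 * y\<^sub>2)
    \<le> real q * dist_int (of_int m\<^sub>1 * x\<^sub>1 + of_int m\<^sub>2 * x\<^sub>2)
      + \<bar>of_int m\<^sub>1\<bar> * dist_int (real q * x\<^sub>1 - y\<^sub>1) + \<bar>of_int m\<^sub>2\<bar> * dist_int (real q * x\<^sub>2 - y\<^sub>2)"
proof -
  define p where "p = round (of_int m\<^sub>1 * x\<^sub>1 + of_int m\<^sub>2 * x\<^sub>2)"
  define p\<^sub>1 where "p\<^sub>1 = round (real q * x\<^sub>1 - y\<^sub>1)"
  define p\<^sub>2 where "p\<^sub>2 = round (real q * x\<^sub>2 - y\<^sub>2)"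
  let ?k = "int q * p - m\<^sub>1 * p\<^sub>1 - m\<^sub>2 * p\<^sub>2"
  let ?A = "real q * (of_int m\<^sub>1 * x\<^sub>1 + of_int m\<^sub>2 * x\<^sub>2 - of_int p)"
  let ?B = "of_int m\<^sub>1 * (real q * x\<^sub>1 - y\<^sub>1 - of_int p\<^sub>1)"
  let ?C = "of_int m\<^sub>2 * (real q * x\<^sub>2 - y\<^sub>2 - of_int p\<^sub>2)"
  have "dist_int (of_int m\<^sub>1 * y\<^sub>1 + of_int m\<^sub>2 * y\<^sub>2)
      \<le> \<bar>of_int m\<^sub>1 * y\<^sub>1 + of_int m\<^sub>2 * y\<^sub>2 - of_int ?k\<bar>"
    by (rule dist_int_le)
  also have "of_int m\<^sub>1 * y\<^sub>1 + of_int m\<^sub>2 * y\<^sub>2 - of_int ?k = ?A - ?B - ?C"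
    by (simp add: algebra_simps)
  also have "\<bar>\<dots>\<bar> \<le> \<bar>?A\<bar> + \<bar>?B\<bar> + \<bar>?C\<bar>"
    by linarith
  finally show ?thesis
    by (simp add: dist_int_def p_def p\<^sub>1_def p\<^sub>2_def abs_mult)
qed

section \<open>Dirichlet vectors at every scale\<close>

text \<open>Pigeonhole: the box holds (M + 1)(N + 1) vectors, but \<open>h\<close>, which tells in
  which of M N equal parts of [0, 1) the fractional part lies, has at most M N values. The
  difference of two vectors sharing a part is the one wanted.\<close>

lemma dirichlet_linear_form:
  fixes M N :: nat and x y :: real
  assumes "0 < M" "0 < N"
  obtains a b :: int where "(a, b) \<noteq> (0, 0)" "\<bar>a\<bar> \<le> int M" "\<bar>b\<bar> \<le> int N"
    "dist_int (of_int a * x + of_int b * y) \<le> 1 / (real M * real N)"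
proof -
  define K where "K = real M * real N"
  have K: "0 < K" using assms by (simp add: K_def)
  define g where "g = (\<lambda>(a::int, b::int). of_int a * x + of_int b * y)"
  define h where "h = (\<lambda>v. \<lfloor>K * frac (g v)\<rfloor>)"
  let ?D = "{0..int M} \<times> {0..int N}"
  have "h ` ?D \<subseteq> {0..<int (M * N)}"
  proof
    fix z assume "z \<in> h ` ?D"
    then obtain v where z: "z = h v" by auto
    have "0 \<le> K * frac (g v)" "K * frac (g v) < K * 1"
      using K frac_lt_1[of "g v"] by (auto intro!: mult_strict_left_mono)
    then show "z \<in> {0..<int (M * N)}"
      by (auto simp: z h_def floor_less_iff K_def)
  qed
  then have "card (h ` ?D) \<le> M * N"
    using card_mono[of "{0..<int (M * N)}"] by (simp add: nat_mult_distrib)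
  also have "\<dots> < card ?D"
    by (simp add: card_cartesian_product nat_add_distrib)
  finally have "\<not> inj_on h ?D" by (rule pigeonhole)
  then obtain v w where vw: "v \<in> ?D" "w \<in> ?D" "v \<noteq> w" "h v = h w"
    by (auto simp: inj_on_def)
  obtain a b c d where v: "v = (a, b)" and w: "w = (c, d)" by (cases v, cases w)
  have "\<bar>K * frac (g v) - K * frac (g w)\<bar> \<le> 1"
    using vw(4) unfolding h_def by linarith
  then have "K * \<bar>frac (g v) - frac (g w)\<bar> \<le> 1"
    using K by (simp add: abs_mult flip: right_diff_distrib)
  then have le: "\<bar>frac (g v) - frac (g w)\<bar> \<le> 1 / K"
    using K by (simp add: field_simps)
  have "dist_int (of_int (a - c) * x + of_int (b - d) * y)
      \<le> \<bar>of_int (a - c) * x + of_int (b - d) * y - of_int (\<lfloor>g v\<rfloor> - \<lfloor>g w\<rfloor>)\<bar>"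
    by (rule dist_int_le)
  also have "of_int (a - c) * x + of_int (b - d) * y - of_int (\<lfloor>g v\<rfloor> - \<lfloor>g w\<rfloor>)
      = frac (g v) - frac (g w)"
    by (simp add: frac_def g_def v w algebra_simps)
  also note le
  finally show ?thesis
    using vw(1-3) by (intro that[of "a - c" "b - d"]) (auto simp: v w K_def)
qed

text \<open>
  One vector per scale: among the integer vectors of exact anisotropic size \<open>X\<^sup>t\<close>, pick the one
  whose value at \<open>(x, y)\<close> is closest to an integer.
\<close>

lemma ex_scale_vectors:
  fixes X :: nat and x y :: real
  assumes X: "2 \<le> X"
  obtains a b :: "nat \<Rightarrow> int" where
    "\<And>t. \<bar>a t\<bar> \<le> int X ^ (2 * t)" "\<And>t. \<bar>b t\<bar> \<le> int X ^ t"
    "\<And>t. int X ^ (2 * t) \<le> \<bar>a t\<bar> * int X ^ 2 \<or> int X ^ t \<le> \<bar>b t\<bar> * int X"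
    "\<And>n. \<exists>t\<le>n. dist_int (of_int (a t) * x + of_int (b t) * y) \<le> 1 / real X ^ (3 * n)"
proof -
  \<comment> \<open>The final disjunction keeps the vector out of the open box of scale t - 1; at t
    = 0 it says that the vector is non-zero.\<close>
  define L where "L = (\<lambda>t. {(a, b). \<bar>a\<bar> \<le> int X ^ (2 * t) \<and> \<bar>b\<bar> \<le> int X ^ t \<and>
    (int X ^ (2 * t) \<le> \<bar>a\<bar> * int X ^ 2 \<or> int X ^ t \<le> \<bar>b\<bar> * int X)})"
  define f where "f = (\<lambda>(a::int, b::int). dist_int (of_int a * x + of_int b * y))"
  define w where "w = (\<lambda>t. arg_min_on f (L t))"
  have fin: "finite (L t)" for t
  proof (rule finite_subset)
    show "L t \<subseteq> {- (int X ^ (2 * t))..int X ^ (2 * t)} \<times> {- (int X ^ t)..int X ^ t}"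
      by (auto simp: L_def)
  qed auto
  have "(int X ^ (2 * t), int X ^ t) \<in> L t" for t
    using X by (auto simp: L_def)
  then have ne: "L t \<noteq> {}" for t by blast
  have wL: "w t \<in> L t" for t
    unfolding w_def by (rule arg_min_if_finite(1)[OF fin ne])
  \<comment> \<open>The Dirichlet vector for the box of scale \<open>n\<close> may be much shorter
    than that box. It lies in \<open>L t\<close> for the least \<open>t\<close> whose box contains
    it, and the minimiser \<open>w t\<close> does at least as well; hence the bound t \<le> n
    instead of t = n.\<close>
  have approx: "\<exists>t\<le>n. f (w t) \<le> 1 / real X ^ (3 * n)" for n
  proof -
    have "0 < X ^ (2 * n)" "0 < X ^ n" using X by auto
    then obtain a b :: int where ab: "(a, b) \<noteq> (0, 0)" "\<bar>a\<bar> \<le> int (X ^ (2 * n))" "\<bar>b\<bar> \<le> int (X ^ n)"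
      "dist_int (of_int a * x + of_int b * y) \<le> 1 / (real (X ^ (2 * n)) * real (X ^ n))"
      by (rule dirichlet_linear_form)
    define Q where "Q = (\<lambda>t. \<bar>a\<bar> \<le> int X ^ (2 * t) \<and> \<bar>b\<bar> \<le> int X ^ t)"
    define t where "t = (LEAST t. Q t)"
    have Qn: "Q n" using ab by (simp add: Q_def)
    then have Qt: "Q t" and tn: "t \<le> n"
      unfolding t_def by (rule LeastI, rule Least_le)
    have "int X ^ (2 * t) \<le> \<bar>a\<bar> * int X ^ 2 \<or> int X ^ t \<le> \<bar>b\<bar> * int X"
    proof (cases t)
      case 0
      have "0 < \<bar>a\<bar> \<or> 0 < \<bar>b\<bar>" using ab(1) by auto
      moreover have "0 < int X" using X by simp
      ultimately have "0 < \<bar>a\<bar> * int X ^ 2 \<or> 0 < \<bar>b\<bar> * int X"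
        by (auto simp: zero_less_mult_iff)
      then show ?thesis using 0 by auto
    next
      case (Suc r)
      then have "\<not> Q r" unfolding t_def by (metis lessI not_less_Least)
      then have "int X ^ (2 * r) \<le> \<bar>a\<bar> \<or> int X ^ r \<le> \<bar>b\<bar>" by (auto simp: Q_def)
      then have "int X ^ (2 * r) * int X ^ 2 \<le> \<bar>a\<bar> * int X ^ 2 \<or> int X ^ r * int X \<le> \<bar>b\<bar> * int X"
        by (auto intro: mult_right_mono)
      then show ?thesis by (simp add: Suc power2_eq_square mult_ac)
    qed
    then have "(a, b) \<in> L t" using Qt by (simp add: L_def Q_def)
    then have "f (w t) \<le> f (a, b)"
      unfolding w_def by (rule arg_min_least[OF fin ne])
    also have "\<dots> \<le> 1 / real X ^ (3 * n)"
      using ab(4) by (simp add: f_def flip: power_add)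
    finally show ?thesis using tn by blast
  qed
  show ?thesis
  proof (rule that[of "\<lambda>t. fst (w t)" "\<lambda>t. snd (w t)"])
    fix t show "\<bar>fst (w t)\<bar> \<le> int X ^ (2 * t)" "\<bar>snd (w t)\<bar> \<le> int X ^ t"
      "int X ^ (2 * t) \<le> \<bar>fst (w t)\<bar> * int X ^ 2 \<or> int X ^ t \<le> \<bar>snd (w t)\<bar> * int X"
      using wL[of t] by (auto simp: L_def)
  next
    fix n show "\<exists>t\<le>n. dist_int (of_int (fst (w t)) * x + of_int (snd (w t)) * y) \<le> 1 / real X ^ (3 * n)"
      using approx[of n] by (simp add: f_def case_prod_beta)
  qed
qed

section \<open>Children spoiled by a linear form\<close>

text \<open>Fix y. Over \<open>N\<close> consecutive integers x the term A x varies by at most 1,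
  and the error is at most 3 |A| \<le> 3, so p is within 4 of A x0 + B y: 9 choices. Given p, x is
  within 3 of (p - B y) / A: 7 choices. This makes 63 per row.\<close>

lemma card_near_integer_le:
  fixes A B \<delta> :: real and N :: nat and x0 :: int and J :: "int set"
  assumes A: "A \<noteq> 0" "\<bar>B\<bar> \<le> \<bar>A\<bar>" "\<delta> \<le> \<bar>A\<bar>" "real N * \<bar>A\<bar> \<le> 1" "0 < N" and J: "finite J"
  shows "card {(x, y). x \<in> {x0..<x0 + int N} \<and> y \<in> J \<and>
      (\<exists>p::int. \<bar>A * of_int x + B * of_int y - of_int p\<bar> < \<delta> + \<bar>A\<bar> + \<bar>B\<bar>)} \<le> 63 * card J"
    (is "card ?S \<le> _")
proof -
  define Z where "Z = (\<lambda>c::real. {i::int. \<bar>of_int i - c\<bar> \<le> 3})"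
  define T where "T = (\<lambda>c::real. {i::int. \<bar>of_int i - c\<bar> \<le> 4})"
  have Z: "finite (Z c)" "card (Z c) \<le> 7" and T: "finite (T c)" "card (T c) \<le> 9" for c :: real
    using card_int_near_le[of 3 c] card_int_near_le[of 4 c] by (auto simp: Z_def T_def)
  define E where "E = (\<lambda>y. \<Union>p\<in>T (A * of_int x0 + B * of_int y). Z ((of_int p - B * of_int y) / A))"
  have E: "finite (E y)" "card (E y) \<le> 63" for y
  proof -
    show "finite (E y)" by (auto simp: E_def Z T)
    have "card (E y) \<le> (\<Sum>p\<in>T (A * of_int x0 + B * of_int y). card (Z ((of_int p - B * of_int y) / A)))"
      unfolding E_def by (rule card_UN_le[OF T(1)])
    also have "\<dots> \<le> (\<Sum>p\<in>T (A * of_int x0 + B * of_int y). 7)"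
      by (intro sum_mono Z)
    also have "\<dots> \<le> 63" using T(2)[of "A * of_int x0 + B * of_int y"] by simp
    finally show "card (E y) \<le> 63" .
  qed
  have A1: "\<bar>A\<bar> \<le> 1"
  proof -
    have "1 * \<bar>A\<bar> \<le> real N * \<bar>A\<bar>" using A(5) by (intro mult_right_mono) auto
    then show ?thesis using A(4) by simp
  qed
  have sub: "?S \<subseteq> (\<Union>y\<in>J. (\<lambda>x. (x, y)) ` E y)"
  proof clarify
    fix x y :: int and p :: int
    assume x: "x \<in> {x0..<x0 + int N}" and y: "y \<in> J"
      and p: "\<bar>A * of_int x + B * of_int y - of_int p\<bar> < \<delta> + \<bar>A\<bar> + \<bar>B\<bar>"
    then have p3: "\<bar>A * of_int x + B * of_int y - of_int p\<bar> \<le> 3 * \<bar>A\<bar>"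
      using A by linarith
    have "of_int x - (of_int p - B * of_int y) / A = (A * of_int x + B * of_int y - of_int p) / A"
      using A(1) by (simp add: field_simps)
    then have "x \<in> Z ((of_int p - B * of_int y) / A)"
      using p3 A(1) by (simp add: Z_def field_simps)
    moreover have "p \<in> T (A * of_int x0 + B * of_int y)"
    proof -
      have "\<bar>A * (of_int x - of_int x0)\<bar> = \<bar>A\<bar> * of_int (x - x0)"
        using x by (simp add: abs_mult)
      also have "\<dots> \<le> \<bar>A\<bar> * real N"
        using x by (intro mult_left_mono) auto
      also have "\<dots> \<le> 1" using A(4) by (simp add: mult.commute)
      finally have "\<bar>A * of_int x - A * of_int x0\<bar> \<le> 1" by (simp add: algebra_simps)
      then show ?thesis using p3 A1 unfolding T_def by simp
    qed
    ultimately show "(x, y) \<in> (\<Union>y\<in>J. (\<lambda>x. (x, y)) ` E y)"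
      using y by (auto simp: E_def)
  qed
  have "card ?S \<le> card (\<Union>y\<in>J. (\<lambda>x. (x, y)) ` E y)"
    by (rule card_mono[OF _ sub]) (use J E in auto)
  also have "\<dots> \<le> (\<Sum>y\<in>J. card ((\<lambda>x. (x, y)) ` E y))"
    by (rule card_UN_le[OF J])
  also have "\<dots> \<le> (\<Sum>y\<in>J. 63)"
    by (intro sum_mono order_trans[OF card_image_le] E)
  finally show ?thesis by simp
qed

lemma vimage_div_int:
  fixes N a :: int
  assumes "0 < N"
  shows "{x. x div N = a} = {N * a..<N * a + N}"
proof (intro set_eqI iffI)
  fix x assume "x \<in> {x. x div N = a}"
  then show "x \<in> {N * a..<N * a + N}"
    using mult_div_mod_eq[of N x] pos_mod_bound[OF assms, of x] pos_mod_sign[OF assms, of x] by auto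
next
  fix x assume "x \<in> {N * a..<N * a + N}"
  then show "x \<in> {x. x div N = a}"
    by (auto intro!: int_div_pos_eq[of _ _ _ "x - N * a"])
qed

text \<open>Counting along the direction of the larger coefficient leaves at most 63 spoiled
  children on each of X or X^2 lines. The term |A| + |B| bounds the variation of the form over a
  unit cell with corner (x, y), so testing the corner controls the whole cell.\<close>

lemma card_children_near_integer_le:
  fixes A B \<delta> :: real and X :: nat and a b :: int
  assumes X: "2 \<le> X" and A: "\<bar>A\<bar> \<le> 1 / real X ^ 2" and B: "\<bar>B\<bar> \<le> 1 / real X"
    and \<delta>: "0 < \<delta>" "\<delta> \<le> max \<bar>A\<bar> \<bar>B\<bar>"
  shows "card {(x, y). x div int X ^ 2 = a \<and> y div int X = b \<and>
      (\<exists>p::int. \<bar>A * of_int x + B * of_int y - of_int p\<bar> < \<delta> + \<bar>A\<bar> + \<bar>B\<bar>)} \<le> 63 * X ^ 2"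
    (is "card ?S \<le> _")
proof -
  define I where "I = {int X ^ 2 * a..<int X ^ 2 * a + int (X ^ 2)}"
  define J where "J = {int X * b..<int X * b + int X}"
  have div: "x div int X ^ 2 = a \<longleftrightarrow> x \<in> I" "x div int X = b \<longleftrightarrow> x \<in> J" for x
    using vimage_div_int[of "int X ^ 2" a] vimage_div_int[of "int X" b] X by (auto simp: I_def J_def)
  show ?thesis
  proof (cases "\<bar>B\<bar> \<le> \<bar>A\<bar>")
    case True
    have "card {(x, y). x \<in> I \<and> y \<in> J \<and>
      (\<exists>p::int. \<bar>A * of_int x + B * of_int y - of_int p\<bar> < \<delta> + \<bar>A\<bar> + \<bar>B\<bar>)} \<le> 63 * card J"
      unfolding I_def by (rule card_near_integer_le) (use True X A \<delta> in \<open>auto simp: field_simps J_def\<close>)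
    also have "\<dots> \<le> 63 * X ^ 2" using X by (simp add: J_def power2_eq_square)
    finally show ?thesis by (simp add: div)
  next
    case False
    have "card {(y, x). y \<in> J \<and> x \<in> I \<and>
      (\<exists>p::int. \<bar>B * of_int y + A * of_int x - of_int p\<bar> < \<delta> + \<bar>B\<bar> + \<bar>A\<bar>)} \<le> 63 * card I"
      (is "card ?T \<le> _")
      unfolding J_def by (rule card_near_integer_le) (use False X B \<delta> in \<open>auto simp: field_simps I_def\<close>)
    also have "card I = X ^ 2" by (simp add: I_def nat_power_eq)
    also have "?T = prod.swap ` ?S" 
      unfolding div by (auto simp: add_ac intro!: image_eqI[where x = "(x, y)" for x y])
    finally show ?thesis by (simp add: card_image)
  qed
qed

section \<open>Branches avoiding forbidden nodes\<close>

text \<open>Let a branch choose each child uniformly from \<open>G\<close>. It passes through a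
  given node of depth \<open>l j\<close> with probability at most 1 / P^(l j), so the expected
  number of forbidden nodes met is below 1. Some child always keeps the conditional bound
  \<open>D\<close> below 1, whereas arriving at a forbidden node would make it at least 1.\<close>

lemma ex_branch_avoiding:
  fixes par :: "'a \<Rightarrow> 'a" and P :: real and G :: "nat \<Rightarrow> 'a \<Rightarrow> 'a set"
    and S :: "nat \<Rightarrow> 'a set" and l :: "nat \<Rightarrow> nat" and root :: 'a
  assumes P: "0 < P" and G: "\<And>n v. finite (G n v)" "\<And>n v. P \<le> real (card (G n v))"
      "\<And>n v u. u \<in> G n v \<Longrightarrow> par u = v"
    and S: "\<And>j. finite (S j)" and sum: "(\<Sum>j. ennreal (real (card (S j)) / P ^ l j)) < 1"
  obtains B where "B 0 = root" "\<And>n. B (Suc n) \<in> G n (B n)" "\<And>j. B (l j) \<notin> S j"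
proof -
  define c where "c = (\<lambda>j n v. card {u \<in> S j. (par ^^ (l j - n)) u = v})"
  \<comment> \<open>The expected number, on a random branch through \<open>v\<close>, of forbidden nodes still to be met.\<close>
  define d where "d = (\<lambda>j n v. if n \<le> l j then ennreal (real (c j n v) / P ^ (l j - n)) else 0)"
  define D where "D = (\<lambda>n v. \<Sum>j. d j n v)"
  have D0: "D 0 root < 1"
  proof -
    have "d j 0 root \<le> ennreal (real (card (S j)) / P ^ l j)" for j
      using P unfolding d_def c_def
      by (auto intro!: ennreal_leI divide_right_mono card_mono S)
    then have "D 0 root \<le> (\<Sum>j. ennreal (real (card (S j)) / P ^ l j))"
      unfolding D_def by (intro suminf_le) auto
    with sum show ?thesis by (rule le_less_trans[rotated])
  qed
  have step: "\<exists>u. D (Suc n) u < 1 \<and> u \<in> G n v" if "D n v < 1" for n v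
  proof (rule ccontr)
    assume "\<nexists>u. D (Suc n) u < 1 \<and> u \<in> G n v"
    then have ge: "1 \<le> D (Suc n) u" if "u \<in> G n v" for u
      using that by (meson not_le)
    \<comment> \<open>Forbidden nodes below different children are distinct and all lie below
      \<open>v\<close>; the weight of each gains a factor \<open>P\<close> on going down one level.
      Once the depth \<open>l j\<close> is reached, the left side is 0.\<close>
    have child: "(\<Sum>u\<in>G n v. d j (Suc n) u) \<le> ennreal P * d j n v" for j
    proof (cases "Suc n \<le> l j")
      case True
      then have lj: "l j - n = Suc (l j - Suc n)" by simp
      have "(\<Sum>u\<in>G n v. c j (Suc n) u) = card (\<Union>u\<in>G n v. {w \<in> S j. (par ^^ (l j - Suc n)) w = u})"
        unfolding c_def by (subst card_UN_disjoint) (auto simp: G S)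
      also have "\<dots> \<le> c j n v"
        unfolding c_def lj by (rule card_mono) (auto simp: S dest: G(3))
      finally have "real (\<Sum>u\<in>G n v. c j (Suc n) u) \<le> real (c j n v)" by (rule of_nat_mono)
      then have "(\<Sum>u\<in>G n v. real (c j (Suc n) u) / P ^ (l j - Suc n)) \<le> P * (real (c j n v) / P ^ (l j - n))"
        using P by (simp add: lj field_simps flip: sum_divide_distrib)
      then have "ennreal (\<Sum>u\<in>G n v. real (c j (Suc n) u) / P ^ (l j - Suc n))
          \<le> ennreal (P * (real (c j n v) / P ^ (l j - n)))"
        by (rule ennreal_leI)
      then show ?thesis
        using True P by (simp add: d_def sum_ennreal flip: ennreal_mult)
    qed (simp add: d_def)
    \<comment> \<open>If no child worked, at least \<open>P\<close> children would each carry
      \<open>D\<close> at least 1, yet their total is at most P times \<open>D n v\<close>, which is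
      below \<open>P\<close>.\<close>
    have "ennreal P \<le> ennreal (real (card (G n v)))" by (intro ennreal_leI G)
    also have "\<dots> = (\<Sum>u\<in>G n v. 1)" by (simp add: ennreal_of_nat_eq_real_of_nat)
    also have "\<dots> \<le> (\<Sum>u\<in>G n v. D (Suc n) u)" by (intro sum_mono ge)
    also have "\<dots> = (\<Sum>j. \<Sum>u\<in>G n v. d j (Suc n) u)"
      unfolding D_def by (rule suminf_sum[symmetric]) simp
    also have "\<dots> \<le> (\<Sum>j. ennreal P * d j n v)" by (intro suminf_le child) auto
    also have "\<dots> = ennreal P * D n v" unfolding D_def by simp
    also have "\<dots> < ennreal P * 1"
      using that P by (intro ennreal_mult_strict_left_mono) auto
    finally show False by simp
  qed
  obtain B where B: "B 0 = root" "\<And>n. D n (B n) < 1" "\<And>n. B (Suc n) \<in> G n (B n)"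
  proof -
    have "\<exists>B. \<forall>n. (D n (B n) < 1 \<and> (n = 0 \<longrightarrow> B n = root)) \<and> B (Suc n) \<in> G n (B n)"
      by (rule dependent_nat_choice) (use D0 step in auto)
    then show ?thesis using that by blast
  qed
  have "B (l j) \<notin> S j" for j
  proof
    assume "B (l j) \<in> S j"
    then have "{u \<in> S j. u = B (l j)} = {B (l j)}" by auto
    then have "1 = d j (l j) (B (l j))" by (simp add: d_def c_def)
    also have "\<dots> = (\<Sum>i\<in>{j}. d i (l j) (B (l j)))" by simp
    also have "\<dots> \<le> D (l j) (B (l j))" unfolding D_def by (rule sum_le_suminf) auto
    finally show False using B(2)[of "l j"] by simp
  qed
  then show ?thesis using B that by blast
qed

section \<open>Limit points of branches and membership in \<open>BAD\<close>\<close>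

text \<open>The closed intervals from a n / N^n to (a n + 1) / N^n are nested, so the supremum of
  the left ends lies in all of them. The conclusion is a n \<le> x N^n \<le> a n + 1, centred at the
  midpoint.\<close>

lemma nested_intervals_point:
  fixes N :: nat and a :: "nat \<Rightarrow> int"
  assumes N: "0 < N" and a: "\<And>n. a (Suc n) div int N = a n"
  obtains x :: real where "\<And>n. \<bar>x * real N ^ n - of_int (a n) - 1/2\<bar> \<le> 1/2"
proof -
  define L where "L = (\<lambda>n. of_int (a n) / real N ^ n)"
  define R where "R = (\<lambda>n. (of_int (a n) + 1) / real N ^ n)"
  have step: "L n \<le> L (Suc n)" "R (Suc n) \<le> R n" for n
  proof -
    have "a (Suc n) \<in> {int N * a n..<int N * a n + int N}"
      using a[of n] vimage_div_int[of "int N" "a n"] N by auto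
    then have "int N * a n \<le> a (Suc n)" "a (Suc n) + 1 \<le> int N * (a n + 1)"
      by (auto simp: algebra_simps)
    then have int: "real_of_int (int N * a n) \<le> of_int (a (Suc n))"
      "real_of_int (a (Suc n) + 1) \<le> of_int (int N * (a n + 1))"
      by (simp_all only: of_int_le_iff)
    have "of_int (int N * a n) / real N ^ Suc n \<le> L (Suc n)"
      "R (Suc n) \<le> of_int (int N * (a n + 1)) / real N ^ Suc n"
      using divide_right_mono[OF int(1), of "real N ^ Suc n"] divide_right_mono[OF int(2), of "real N ^ Suc n"]
      by (simp_all add: L_def R_def)
    moreover have "L n = of_int (int N * a n) / real N ^ Suc n"
      "R n = of_int (int N * (a n + 1)) / real N ^ Suc n"
      using N by (simp_all add: L_def R_def)
    ultimately show "L n \<le> L (Suc n)" "R (Suc n) \<le> R n"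
      by (simp_all only:)
  qed
  have mono: "L m \<le> L n" "R n \<le> R m" if "m \<le> n" for m n
    using lift_Suc_mono_le[of L, OF step(1) that] lift_Suc_antimono_le[of R, OF step(2) that] by auto
  have LR: "L m \<le> R n" for m n
  proof -
    have "L m \<le> L (max m n)" by (rule mono) simp
    also have "\<dots> \<le> R (max m n)" using N by (simp add: L_def R_def divide_right_mono)
    also have "\<dots> \<le> R n" by (rule mono) simp
    finally show ?thesis .
  qed
  define x where "x = (SUP n. L n)"
  have "bdd_above (range L)" using LR by (auto intro!: bdd_aboveI[of _ "R 0"])
  then have x: "L n \<le> x" "x \<le> R n" for n
    using LR by (auto simp: x_def intro!: cSUP_upper cSUP_least)
  have "\<bar>x * real N ^ n - of_int (a n) - 1/2\<bar> \<le> 1/2" for n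
  proof -
    have "of_int (a n) \<le> x * real N ^ n" "x * real N ^ n \<le> of_int (a n) + 1"
      using x[of n] N by (auto simp: L_def R_def field_simps)
    then show ?thesis by linarith
  qed
  then show ?thesis by (rule that)
qed

text \<open>Transference with a scale \<open>n\<close> such that X^(3n) is comparable to q. The term
  q times the distance of the form at \<Theta> uses at most half of the guaranteed 1 / X^4; the
  other half must come from the two coordinates, whose coefficients are O(q^(2/3)) and
  O(q^(1/3)).\<close>

lemma BAD_memI:
  fixes X :: nat and a b :: "nat \<Rightarrow> int"
  assumes X: "2 \<le> X"
    and a: "\<And>t. \<bar>a t\<bar> \<le> int X ^ (2 * t)" and b: "\<And>t. \<bar>b t\<bar> \<le> int X ^ t"
    and approx: "\<And>n. \<exists>t\<le>n. dist_int (of_int (a t) * fst \<Theta> + of_int (b t) * snd \<Theta>) \<le> 1 / real X ^ (3 * n)"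
    and far: "\<And>t. 1 / real X ^ 4 \<le> dist_int (of_int (a t) * \<eta>\<^sub>1 + of_int (b t) * \<eta>\<^sub>2)"
  shows "(\<eta>\<^sub>1, \<eta>\<^sub>2) \<in> BAD \<Theta> (2/3) (1/3)"
proof -
  have X0: "0 < real X" "1 < real X" using X by auto
  have bound: "1 / (4 * real X ^ 10) \<le> max (real q powr (2/3) * dist_int (real q * fst \<Theta> - \<eta>\<^sub>1))
            (real q powr (1/3) * dist_int (real q * snd \<Theta> - \<eta>\<^sub>2))" (is "_ \<le> max ?u ?v")
    if q: "0 < q" for q :: nat
  proof -
    \<comment> \<open>\<open>Q n\<close> says exactly that q / X^(3n) is at most 1 / (2 X^4);
      minimality of \<open>n\<close> bounds X^(3n) by a multiple of q.\<close>
    define Q where "Q = (\<lambda>n. 2 * real q * real X ^ 4 \<le> real X ^ (3 * n))"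
    define n where "n = (LEAST n. Q n)"
    have "1 < real X ^ 3" using X0(2) by (rule one_less_power) simp
    from real_arch_pow[OF this] obtain k where "2 * real q * real X ^ 4 < (real X ^ 3) ^ k" by blast
    then have "Q k" by (simp add: Q_def power_mult)
    then have Qn: "Q n" unfolding n_def by (rule LeastI)
    have "1 * 1 < 2 * real q * real X ^ 4"
      using q X0 by (intro mult_less_le_imp_less) (auto intro: one_le_power)
    then have "\<not> Q 0" by (simp add: Q_def)
    with Qn obtain m where m: "n = Suc m" by (cases n) auto
    then have "\<not> Q m" unfolding n_def by (metis lessI not_less_Least)
    then have "real X ^ (3 * m) * real X ^ 3 \<le> 2 * real q * real X ^ 4 * real X ^ 3"
      by (intro mult_right_mono) (auto simp: Q_def)
    then have "real X ^ (3 * n) \<le> 2 * (real q * real X ^ 7)"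
      by (simp add: m mult_ac flip: power_add)
    \<comment> \<open>Wasting the factor 2 as X^2 makes the exponent 9 divisible by 3, ready for the
      cube root.\<close>
    also have "\<dots> \<le> real X ^ 2 * (real q * real X ^ 7)"
      using power_mono[of 2 "real X" 2] X by (intro mult_right_mono) auto
    finally have le9: "real X ^ (3 * n) \<le> real q * real X ^ 9"
      by (simp add: mult_ac flip: power_add)
    define z where "z = real q powr (1/3)"
    have z0: "0 < z" using q by (simp add: z_def)
    have z3: "z ^ 3 = real q" and z2: "z ^ 2 = real q powr (2/3)"
      using q by (simp_all add: z_def powr_power)
    have "(real X ^ n) ^ 3 \<le> (real X ^ 3 * z) ^ 3"
      using le9 by (simp add: power_mult_distrib z3 mult_ac flip: power_mult)
    then have n1: "real X ^ n \<le> real X ^ 3 * z"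
      using z0 X0 by (simp add: power_mono_iff)
    then have "(real X ^ n) ^ 2 \<le> (real X ^ 3 * z) ^ 2"
      by (intro power_mono) auto
    then have n2: "real X ^ (2 * n) \<le> real X ^ 6 * z ^ 2"
      by (simp add: power_mult_distrib mult_ac flip: power_mult)
    have "real X ^ 3 * z \<le> real X ^ 6 * z"
      using z0 X0 by (intro mult_right_mono power_increasing) auto
    with n1 have n1': "real X ^ n \<le> real X ^ 6 * z" by linarith
    obtain t where t: "t \<le> n"
      "dist_int (of_int (a t) * fst \<Theta> + of_int (b t) * snd \<Theta>) \<le> 1 / real X ^ (3 * n)"
      using approx by blast
    have D0: "0 \<le> dist_int x" for x by (simp add: dist_int_def)
    have "real_of_int \<bar>a t\<bar> \<le> of_int (int X ^ (2 * t))" "real_of_int \<bar>b t\<bar> \<le> of_int (int X ^ t)"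
      using a[of t] b[of t] by (simp_all only: of_int_le_iff)
    then have "\<bar>real_of_int (a t)\<bar> \<le> real X ^ (2 * t)" "\<bar>real_of_int (b t)\<bar> \<le> real X ^ t"
      by simp_all
    moreover have "real X ^ (2 * t) \<le> real X ^ (2 * n)" "real X ^ t \<le> real X ^ n"
      using X0 t(1) by (auto intro!: power_increasing)
    ultimately have ab: "\<bar>real_of_int (a t)\<bar> \<le> real X ^ 6 * z ^ 2" "\<bar>real_of_int (b t)\<bar> \<le> real X ^ 6 * z"
      using n1' n2 by linarith+
    let ?D1 = "dist_int (real q * fst \<Theta> - \<eta>\<^sub>1)" and ?D2 = "dist_int (real q * snd \<Theta> - \<eta>\<^sub>2)"
    have "real q * dist_int (of_int (a t) * fst \<Theta> + of_int (b t) * snd \<Theta>) \<le> real q * (1 / real X ^ (3 * n))"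
      by (intro mult_left_mono t) auto
    also have "\<dots> \<le> 1 / (2 * real X ^ 4)"
      using Qn X0 by (simp add: Q_def field_simps)
    finally have "1 / real X ^ 4 \<le> 1 / (2 * real X ^ 4) + \<bar>of_int (a t)\<bar> * ?D1 + \<bar>of_int (b t)\<bar> * ?D2"
      using far[of t] dist_int_scaled_sum_le[of "a t" \<eta>\<^sub>1 "b t" \<eta>\<^sub>2 q "fst \<Theta>" "snd \<Theta>"] by linarith
    moreover have "\<bar>of_int (a t)\<bar> * ?D1 \<le> real X ^ 6 * z ^ 2 * ?D1"
      "\<bar>of_int (b t)\<bar> * ?D2 \<le> real X ^ 6 * z * ?D2"
      by (intro mult_right_mono ab D0)+
    \<comment> \<open>Dividing the remaining half by the factor X^6 of the coefficient bounds gives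
      1 / (2 X^10), and the maximum of two terms is at least half their sum: hence the constant 1 /
      (4 X^10).\<close>
    moreover have "1 / real X ^ 4 - 1 / (2 * real X ^ 4) = real X ^ 6 * (2 * (1 / (4 * real X ^ 10)))"
      using X0 by (simp add: field_simps flip: power_add)
    ultimately have "real X ^ 6 * (2 * (1 / (4 * real X ^ 10))) \<le> real X ^ 6 * (z ^ 2 * ?D1 + z * ?D2)"
      by (simp add: algebra_simps)
    then have "2 * (1 / (4 * real X ^ 10)) \<le> z ^ 2 * ?D1 + z * ?D2"
      using X0 by (subst (asm) mult_le_cancel_left_pos) auto
    then show ?thesis unfolding z2 unfolding z_def by linarith
  qed
  have "0 < 1 / (4 * real X ^ 10)" using X0 by simp
  also have "\<dots> \<le> (INF q\<in>{q::nat. 0 < q}. max (real q powr (2/3) * dist_int (real q * fst \<Theta> - \<eta>\<^sub>1))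
            (real q powr (1/3) * dist_int (real q * snd \<Theta> - \<eta>\<^sub>2)))"
    by (rule cINF_greatest) (use bound in auto)
  finally show ?thesis by (simp add: BAD_def)
qed

section \<open>Cells met by a small set, and the choice of scales\<close>

text \<open>Compare with one fixed point of \<open>U\<close>. With Y = X^l and d Y \<le> 1, the
  rescaled coordinates move by at most Y and 1, leaving at most 2 (1 + Y) + 1 \<le> 5 Y columns and
  5 rows. The cells are closed, so a boundary point counts for every cell containing it.\<close>

lemma card_cells_meeting_le:
  fixes X l :: nat and d :: real and U :: "(real \<times> real) set"
  assumes X: "0 < X" and U: "bounded U" "diameter U \<le> d" and d: "0 < d" "real X ^ l * d \<le> 1"
  defines "S \<equiv> {(a::int, b::int). \<exists>(x, y)\<in>U. \<bar>x * real X ^ (2 * l) - of_int a - 1/2\<bar> \<le> 1/2 \<and>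
      \<bar>y * real X ^ l - of_int b - 1/2\<bar> \<le> 1/2}"
  shows "finite S" "real (card S) \<le> 25 * real X ^ l"
proof -
  have "finite S \<and> real (card S) \<le> 25 * real X ^ l"
  proof (cases "U = {}")
    case False
    then obtain x0 y0 where p0: "(x0, y0) \<in> U" by auto
    define Y where "Y = real X ^ l"
    have Y: "1 \<le> Y" using X by (simp add: Y_def one_le_power)
    define I where "I = {i::int. \<bar>of_int i - x0 * Y ^ 2\<bar> \<le> 1 + Y}"
    define J where "J = {i::int. \<bar>of_int i - y0 * Y\<bar> \<le> 2}"
    have I: "finite I" "real (card I) \<le> 5 * Y" and J: "finite J" "real (card J) \<le> 5"
      using card_int_near_le[of "1 + Y" "x0 * Y ^ 2"] card_int_near_le[of 2 "y0 * Y"] Y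
      by (auto simp: I_def J_def)
    have sub: "S \<subseteq> I \<times> J"
    proof
      fix v assume "v \<in> S"
      then obtain a b x y where v: "v = (a, b)" and xy: "(x, y) \<in> U"
        and a: "\<bar>x * Y ^ 2 - of_int a - 1/2\<bar> \<le> 1/2" and b: "\<bar>y * Y - of_int b - 1/2\<bar> \<le> 1/2"
        by (auto simp: S_def Y_def power_mult[symmetric] mult.commute[of l])
      have "dist (x, y) (x0, y0) \<le> d"
        using diameter_bounded_bound[OF U(1) xy p0] U(2) by simp
      then have "\<bar>x - x0\<bar> \<le> d" "\<bar>y - y0\<bar> \<le> d"
        using dist_fst_le[of "(x, y)" "(x0, y0)"] dist_snd_le[of "(x, y)" "(x0, y0)"]
        by (auto simp: dist_real_def)
      then have "\<bar>x - x0\<bar> * Y \<le> d * Y" "\<bar>y - y0\<bar> * Y \<le> d * Y"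
        using Y by (auto intro: mult_right_mono)
      then have y1: "\<bar>x - x0\<bar> * Y \<le> 1" "\<bar>y - y0\<bar> * Y \<le> 1"
        using d(2) by (auto simp: Y_def mult.commute)
      then have "\<bar>x - x0\<bar> * Y * Y \<le> 1 * Y" using Y by (intro mult_right_mono) auto
      then have "\<bar>x * Y ^ 2 - x0 * Y ^ 2\<bar> \<le> Y" "\<bar>y * Y - y0 * Y\<bar> \<le> 1"
        using Y y1 abs_mult[of "x - x0" "Y ^ 2"] abs_mult[of "y - y0" Y]
        by (auto simp: algebra_simps power2_eq_square)
      then have "\<bar>of_int a - x0 * Y ^ 2\<bar> \<le> 1 + Y" "\<bar>of_int b - y0 * Y\<bar> \<le> 2"
        using a b by linarith+
      then show "v \<in> I \<times> J" by (simp add: v I_def J_def)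
    qed
    have "real (card S) \<le> real (card (I \<times> J))"
      using I J by (intro of_nat_mono card_mono sub) auto
    also have "\<dots> \<le> (5 * Y) * 5"
      unfolding card_cartesian_product of_nat_mult by (intro mult_mono I J) (use Y in auto)
    finally show ?thesis using finite_subset[OF sub] I J by (simp add: Y_def)
  qed (simp add: S_def)
  then show "finite S" "real (card S) \<le> 25 * real X ^ l" by auto
qed

text \<open>The cell has X^2 X = X^3 children; the spoiled ones are removed. This bounds the
  branching number from below.\<close>

lemma card_children_far_from_integer_ge:
  fixes A B \<delta> :: real and X :: nat and a b :: int
  assumes X: "2 \<le> X" and A: "\<bar>A\<bar> \<le> 1 / real X ^ 2" and B: "\<bar>B\<bar> \<le> 1 / real X"
    and \<delta>: "0 < \<delta>" "\<delta> \<le> max \<bar>A\<bar> \<bar>B\<bar>"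
  defines "G \<equiv> {(x, y). x div int X ^ 2 = a \<and> y div int X = b \<and>
      (\<forall>p::int. \<delta> + \<bar>A\<bar> + \<bar>B\<bar> \<le> \<bar>A * of_int x + B * of_int y - of_int p\<bar>)}"
  shows "finite G" "real X ^ 3 - 63 * real X ^ 2 \<le> real (card G)"
proof -
  define C where "C = {x. x div int X ^ 2 = a} \<times> {y. y div int X = b}"
  define F where "F = {(x, y). x div int X ^ 2 = a \<and> y div int X = b \<and>
      (\<exists>p::int. \<bar>A * of_int x + B * of_int y - of_int p\<bar> < \<delta> + \<bar>A\<bar> + \<bar>B\<bar>)}"
  have eq: "C = {int X ^ 2 * a..<int X ^ 2 * a + int X ^ 2} \<times> {int X * b..<int X * b + int X}"
    using X unfolding C_def by (simp add: vimage_div_int)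
  have finC: "finite C" by (simp add: eq)
  have "card C = X ^ 2 * X" by (simp add: eq card_cartesian_product nat_power_eq)
  then have cardC: "card C = X ^ 3" by (simp add: power3_eq_cube power2_eq_square)
  have GF: "C = G \<union> F" by (auto simp: C_def G_def F_def not_less)
  then show "finite G" using finC by simp
  have "X ^ 3 \<le> card G + card F"
    using card_Un_le[of G F] by (simp add: cardC flip: GF)
  also have "card F \<le> 63 * X ^ 2"
    unfolding F_def by (rule card_children_near_integer_le[OF X A B \<delta>])
  finally have "real (X ^ 3) \<le> real (card G + 63 * X ^ 2)" by (intro of_nat_mono) auto
  then show "real X ^ 3 - 63 * real X ^ 2 \<le> real (card G)" by simp
qed

text \<open>Each subtrahend costs at most half of X^3: X \<ge> 126 gives 63 X^2 \<le> X^3 / 2, and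
  X^(2 - s) \<ge> 2 gives X^(s + 1) \<le> X^3 / 2.\<close>

lemma ex_large_scale:
  fixes s :: real
  assumes "s < 2"
  obtains X :: nat where "2 \<le> X" "real X powr (s + 1) \<le> real X ^ 3 - 63 * real X ^ 2"
proof -
  define X where "X = nat \<lceil>max 126 (2 powr (1 / (2 - s)))\<rceil>"
  have X: "126 \<le> real X" "2 powr (1 / (2 - s)) \<le> real X"
    unfolding X_def by linarith+
  have "(2 powr (1 / (2 - s))) powr (2 - s) \<le> real X powr (2 - s)"
    using assms X by (intro powr_mono2) auto
  then have "2 * real X powr (s + 1) \<le> real X powr (2 - s) * real X powr (s + 1)"
    using assms by (intro mult_right_mono) (auto simp: powr_powr)
  also have "\<dots> = real X ^ 3"
    using X by (simp flip: powr_add)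
  finally have "2 * real X powr (s + 1) \<le> real X ^ 3" .
  moreover have "126 * real X ^ 2 \<le> real X * real X ^ 2" using X by (intro mult_right_mono) auto
  ultimately have "real X powr (s + 1) \<le> real X ^ 3 - 63 * real X ^ 2"
    by (simp add: power3_eq_cube power2_eq_square)
  with X show ?thesis by (intro that) auto
qed

lemma ex_scale_of_diameter:
  fixes X :: nat and d :: real
  assumes "2 \<le> X" "0 < d" "d \<le> 1"
  obtains l where "real X ^ l * d \<le> 1" "1 < real X ^ Suc l * d"
proof -
  define Q where "Q = (\<lambda>l. 1 < real X ^ l * d)"
  have "1 < real X" using assms by simp
  from real_arch_pow[OF this] obtain k where "1 / d < real X ^ k" by blast
  then have "Q k" using assms by (simp add: Q_def field_simps)
  moreover have "\<not> Q 0" using assms by (simp add: Q_def)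
  ultimately obtain l where "\<not> Q l" "Q (Suc l)"
    by (metis not0_implies_Suc LeastI not_less_Least lessI)
  then show ?thesis by (intro that) (auto simp: Q_def)
qed

section \<open>The lower bound: cheap covers miss a point\<close>

text \<open>Both non-emptiness and the lower bound on the dimension come from here. Branches of
  unspoiled cells converge to points of \<open>BAD\<close>; the forbidden nodes are the cells
  meeting \<open>U j\<close> at the depth matching its diameter.\<close>

theorem BAD_not_covered:
  fixes \<Theta> :: "real \<times> real" and s :: real
  assumes s: "1 \<le> s" "s < 2"
  obtains c :: real where "0 < c"
    "\<And>U :: nat \<Rightarrow> (real \<times> real) set. \<lbrakk>\<And>j. bounded (U j); \<And>j. diameter (U j) \<le> 1;
       (\<Sum>j. ennreal (diameter (U j) powr s)) < ennreal c\<rbrakk> \<Longrightarrow> \<not> BAD \<Theta> (2/3) (1/3) \<subseteq> (\<Union>j. U j)"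
proof -
  obtain X :: nat where X: "2 \<le> X" and XP: "real X powr (s + 1) \<le> real X ^ 3 - 63 * real X ^ 2"
    using ex_large_scale[OF s(2)] .
  have X0: "0 < real X" "1 < real X" using X by auto
  define P where "P = real X powr (s + 1)"
  have P: "0 < P" using X0 by (simp add: P_def)
  obtain a b :: "nat \<Rightarrow> int" where a: "\<And>t. \<bar>a t\<bar> \<le> int X ^ (2 * t)" and b: "\<And>t. \<bar>b t\<bar> \<le> int X ^ t"
    and ab: "\<And>t. int X ^ (2 * t) \<le> \<bar>a t\<bar> * int X ^ 2 \<or> int X ^ t \<le> \<bar>b t\<bar> * int X"
    and approx: "\<And>n. \<exists>t\<le>n. dist_int (of_int (a t) * fst \<Theta> + of_int (b t) * snd \<Theta>) \<le> 1 / real X ^ (3 * n)"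
    by (rule ex_scale_vectors[OF X, of "fst \<Theta>" "snd \<Theta>"]) (rule that)
  \<comment> \<open>Coefficients of the form in coordinates rescaled so that a cell of depth t + 1
    is a unit square.\<close>
  define A where "A = (\<lambda>t. of_int (a t) / real X ^ (2 * Suc t))"
  define B where "B = (\<lambda>t. of_int (b t) / real X ^ Suc t)"
  \<comment> \<open>The size condition on the vectors gives |A t| \<ge> X^(-4) or |B t| \<ge>
    X^(-2); X^(-4) is also the distance that \<open>BAD_memI\<close> asks for.\<close>
  define \<delta> where "\<delta> = 1 / real X ^ 4"
  have \<delta>: "0 < \<delta>" using X0 by (simp add: \<delta>_def)
  have A_le: "\<bar>A t\<bar> \<le> 1 / real X ^ 2" and B_le: "\<bar>B t\<bar> \<le> 1 / real X" for t
  proof -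
    have "real_of_int \<bar>a t\<bar> \<le> of_int (int X ^ (2 * t))" "real_of_int \<bar>b t\<bar> \<le> of_int (int X ^ t)"
      using a[of t] b[of t] by (simp_all only: of_int_le_iff)
    then show "\<bar>A t\<bar> \<le> 1 / real X ^ 2" "\<bar>B t\<bar> \<le> 1 / real X"
      using X0 by (simp_all add: A_def B_def field_simps power2_eq_square)
  qed
  have AB_ge: "\<delta> \<le> max \<bar>A t\<bar> \<bar>B t\<bar>" for t
  proof -
    consider "real_of_int (int X ^ (2 * t)) \<le> of_int (\<bar>a t\<bar> * int X ^ 2)"
      | "real_of_int (int X ^ t) \<le> of_int (\<bar>b t\<bar> * int X)"
      using ab[of t] by (auto simp only: of_int_le_iff)
    then show ?thesis
    proof cases
      case 1
      then have "real X ^ (2 * t) / real X ^ (2 * t + 4) \<le> \<bar>of_int (a t)\<bar> * real X ^ 2 / real X ^ (2 * t + 4)"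
        by (intro divide_right_mono) auto
      also have "\<dots> = \<bar>A t\<bar>"
        using X0 by (simp add: A_def power_add eval_nat_numeral)
      also have "real X ^ (2 * t) / real X ^ (2 * t + 4) = \<delta>"
        using X0 by (simp add: \<delta>_def power_add)
      finally show ?thesis by simp
    next
      case 2
      then have "real X ^ t / real X ^ (t + 2) \<le> \<bar>of_int (b t)\<bar> * real X / real X ^ (t + 2)"
        by (intro divide_right_mono) auto
      also have "\<dots> = \<bar>B t\<bar>"
        using X0 by (simp add: B_def power_add eval_nat_numeral)
      also have "real X ^ t / real X ^ (t + 2) = 1 / real X ^ 2"
        using X0 by (simp add: power_add power2_eq_square)
      finally have "1 / real X ^ 2 \<le> \<bar>B t\<bar>" .
      moreover have "\<delta> \<le> 1 / real X ^ 2"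
        unfolding \<delta>_def using X0 by (intro divide_left_mono power_increasing) auto
      ultimately show ?thesis by simp
    qed
  qed
  \<comment> \<open>A node (u, v) of depth n stands for the rectangle with corner (u / X^(2n), v /
    X^n) and sides X^(-2n), X^(-n); integer division finds the parent.\<close>
  define par where "par = (\<lambda>(x, y). (x div int X ^ 2, y div int X))"
  define G where "G = (\<lambda>t v. {(x, y). x div int X ^ 2 = fst v \<and> y div int X = snd v \<and>
      (\<forall>p::int. \<delta> + \<bar>A t\<bar> + \<bar>B t\<bar> \<le> \<bar>A t * of_int x + B t * of_int y - of_int p\<bar>)})"
  have finG: "finite (G t v)" and cardG: "P \<le> real (card (G t v))" for t v
    using card_children_far_from_integer_ge[OF X A_le[of t] B_le[of t] \<delta> AB_ge[of t],
        where a = "fst v" and b = "snd v"] XP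
    unfolding G_def P_def by linarith+
  have parG: "par u = v" if "u \<in> G t v" for t u v
    using that by (auto simp: G_def par_def)
  \<comment> \<open>Chosen so that 25 X^s (c + c) = 1: one \<open>c\<close> for the cover, one for
    the total of the artificial diameters \<open>e j\<close>.\<close>
  define c where "c = 1 / (50 * real X powr s)"
  have c: "0 < c" using X0 by (simp add: c_def)
  have "1 \<le> real X powr s" using X0 s by (intro ge_one_powr_ge_zero) auto
  then have c1: "c \<le> 1" using X0 by (simp add: c_def divide_le_eq_1)
  show ?thesis
  proof (rule that[OF c])
    fix U :: "nat \<Rightarrow> (real \<times> real) set"
    assume U: "\<And>j. bounded (U j)" "\<And>j. diameter (U j) \<le> 1"
      and sum: "(\<Sum>j. ennreal (diameter (U j) powr s)) < ennreal c"
    \<comment> \<open>Sets of diameter \<open>0\<close> have no scale of their own; they are given a summable one.\<close>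
    define e where "e = (\<lambda>j. c * (1/2) ^ Suc j)"
    define d where "d = (\<lambda>j. max (diameter (U j)) (e j))"
    have e: "0 < e j" "e j \<le> 1" for j
    proof -
      show "0 < e j" using c by (simp add: e_def)
      have "c * (1/2) ^ Suc j \<le> 1 * 1" using c c1 by (intro mult_mono power_le_one) auto
      then show "e j \<le> 1" by (simp add: e_def)
    qed
    have d: "0 < d j" "d j \<le> 1" "diameter (U j) \<le> d j" for j
      using e[of j] U(2)[of j] by (auto simp: d_def)
    have "\<exists>l. real X ^ l * d j \<le> 1 \<and> 1 < real X ^ Suc l * d j" for j
      using ex_scale_of_diameter[OF X d(1,2)[of j]] by metis
    then obtain l where l: "\<And>j. real X ^ l j * d j \<le> 1" "\<And>j. 1 < real X ^ Suc (l j) * d j"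
      by metis
    define S where "S = (\<lambda>j. {(a::int, b::int). \<exists>(x, y)\<in>U j. \<bar>x * real X ^ (2 * l j) - of_int a - 1/2\<bar> \<le> 1/2 \<and>
      \<bar>y * real X ^ l j - of_int b - 1/2\<bar> \<le> 1/2})"
    have finS: "finite (S j)" and cardS: "real (card (S j)) \<le> 25 * real X ^ l j" for j
      unfolding S_def using card_cells_meeting_le[OF _ U(1) d(3,1) l(1), of j] X by auto
    \<comment> \<open>With Y = X^(l j) the quotient is at most 25 / Y^s, and X Y d > 1 turns this
      into 25 X^s d^s. Since e j \<le> 1 \<le> s, the power of \<open>e j\<close> is at most
      \<open>e j\<close> itself.\<close>
    have weight: "real (card (S j)) / P ^ l j \<le> 25 * real X powr s * (diameter (U j) powr s + e j)" for j
    proof -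
      define Y where "Y = real X ^ l j"
      have Y: "0 < Y" using X0 by (simp add: Y_def)
      have "P ^ l j = Y powr (s + 1)"
        using X0 by (simp add: P_def Y_def powr_powr mult_ac flip: powr_realpow)
      also have "\<dots> = Y powr s * Y" using Y by (simp add: powr_add)
      finally have Pl: "P ^ l j = Y powr s * Y" .
      have "real (card (S j)) / P ^ l j \<le> 25 * Y / (Y powr s * Y)"
        unfolding Pl using cardS[of j] Y by (intro divide_right_mono) (auto simp: Y_def)
      also have "\<dots> = 25 * (1 / Y powr s)" using Y by simp
      also have "1 / Y powr s \<le> real X powr s * d j powr s"
      proof -
        have "1 \<le> (real X * Y * d j) powr s"
          using l(2)[of j] s by (intro ge_one_powr_ge_zero) (auto simp: Y_def)
        then show ?thesis
          using X0 Y d(1)[of j] by (simp add: powr_mult field_simps)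
      qed
      also have "d j powr s \<le> diameter (U j) powr s + e j"
      proof -
        have "e j powr s \<le> e j powr 1" using e[of j] s by (intro powr_mono') auto
        then show ?thesis using e[of j] by (auto simp: d_def max_def intro: order_trans)
      qed
      finally show ?thesis using X0 by simp
    qed
    have "(\<Sum>j. ennreal (real (card (S j)) / P ^ l j))
        \<le> (\<Sum>j. ennreal (25 * real X powr s) * (ennreal (diameter (U j) powr s) + ennreal (e j)))"
    proof (intro suminf_le)
      fix j
      have "ennreal (real (card (S j)) / P ^ l j) \<le> ennreal (25 * real X powr s * (diameter (U j) powr s + e j))"
        by (intro ennreal_leI weight)
      then show "ennreal (real (card (S j)) / P ^ l j)
          \<le> ennreal (25 * real X powr s) * (ennreal (diameter (U j) powr s) + ennreal (e j))"
        using e(1)[of j] by (simp add: ennreal_mult ennreal_plus less_imp_le)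
    qed auto
    also have "\<dots> = ennreal (25 * real X powr s) * ((\<Sum>j. ennreal (diameter (U j) powr s)) + (\<Sum>j. ennreal (e j)))"
      by (simp add: suminf_add)
    also have "(\<Sum>j. ennreal (e j)) = ennreal c"
    proof -
      have "e sums c" unfolding e_def using sums_mult[OF power_half_series, of c] by simp
      then show ?thesis using e(1) by (intro suminf_ennreal_eq) (auto simp: less_imp_le)
    qed
    also have "ennreal (25 * real X powr s) * ((\<Sum>j. ennreal (diameter (U j) powr s)) + ennreal c)
        < ennreal (25 * real X powr s) * (ennreal c + ennreal c)"
    proof (rule ennreal_mult_strict_left_mono)
      show "(\<Sum>j. ennreal (diameter (U j) powr s)) + ennreal c < ennreal c + ennreal c"
        using sum by (subst (1) add.commute) (simp only: ennreal_add_left_cancel_less ennreal_neq_top, simp)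
    qed (use X0 in \<open>simp_all add: ennreal_mult_less_top\<close>)
    also have "\<dots> = 1"
    proof -
      have "ennreal (25 * real X powr s) * (ennreal c + ennreal c) = ennreal (25 * real X powr s * (c + c))"
        using c by (subst ennreal_mult, simp, simp, subst ennreal_plus) auto
      also have "25 * real X powr s * (c + c) = 1" using X0 by (simp add: c_def)
      finally show ?thesis by simp
    qed
    finally have small: "(\<Sum>j. ennreal (real (card (S j)) / P ^ l j)) < 1" .
    obtain V where V: "\<And>n. V (Suc n) \<in> G n (V n)" "\<And>j. V (l j) \<notin> S j"
      by (rule ex_branch_avoiding[where root = "(0, 0)", OF P finG cardG parG finS small]) (assumption, rule that)
    have div: "fst (V (Suc n)) div int (X ^ 2) = fst (V n)" "snd (V (Suc n)) div int X = snd (V n)" for n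
      using V(1)[of n] by (auto simp: G_def)
    have pos: "0 < X ^ 2" "0 < X" using X by auto
    obtain x :: real where x: "\<And>n. \<bar>x * real (X ^ 2) ^ n - of_int (fst (V n)) - 1/2\<bar> \<le> 1/2"
      by (rule nested_intervals_point[where a = "\<lambda>n. fst (V n)", OF pos(1) div(1)]) (rule that)
    obtain y :: real where y: "\<And>n. \<bar>y * real X ^ n - of_int (snd (V n)) - 1/2\<bar> \<le> 1/2"
      by (rule nested_intervals_point[where a = "\<lambda>n. snd (V n)", OF pos(2) div(2)]) (rule that)
    have x': "\<bar>x * real X ^ (2 * n) - of_int (fst (V n)) - 1/2\<bar> \<le> 1/2" for n
      using x[of n] by (simp add: power_mult)
    have "(x, y) \<in> BAD \<Theta> (2/3) (1/3)"
    proof (rule BAD_memI[OF X a b approx])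
      fix t
      define p where "p = round (of_int (a t) * x + of_int (b t) * y)"
      define x1 where "x1 = real_of_int (fst (V (Suc t)))"
      define y1 where "y1 = real_of_int (snd (V (Suc t)))"
      \<comment> \<open>The rescaled limit point is within 1 of the corner in each coordinate, so
        passing from corner to point costs at most |A t| + |B t|, the slack built into
        \<open>G\<close>.\<close>
      have "\<delta> + \<bar>A t\<bar> + \<bar>B t\<bar> \<le> \<bar>A t * x1 + B t * y1 - of_int p\<bar>"
        using V(1)[of t] by (auto simp: G_def x1_def y1_def)
      moreover have "\<bar>A t * (x * real X ^ (2 * Suc t) - x1)\<bar> \<le> \<bar>A t\<bar> * 1"
        "\<bar>B t * (y * real X ^ Suc t - y1)\<bar> \<le> \<bar>B t\<bar> * 1"
        using x'[of "Suc t"] y[of "Suc t"] unfolding abs_mult x1_def y1_def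
        by (intro mult_left_mono; linarith)+
      moreover have "A t * (x * real X ^ (2 * Suc t) - x1) = of_int (a t) * x - A t * x1"
        "B t * (y * real X ^ Suc t - y1) = of_int (b t) * y - B t * y1"
        using X0 by (simp_all add: A_def B_def right_diff_distrib)
      ultimately have "\<delta> \<le> \<bar>of_int (a t) * x + of_int (b t) * y - of_int p\<bar>"
        by linarith
      then show "1 / real X ^ 4 \<le> dist_int (of_int (a t) * x + of_int (b t) * y)"
        by (simp add: dist_int_def p_def \<delta>_def)
    qed
    moreover have "(x, y) \<notin> U j" for j
    proof
      assume "(x, y) \<in> U j"
      then have "V (l j) \<in> S j"
        using x'[of "l j"] y[of "l j"] 
        by (auto simp: S_def case_prod_beta intro!: bexI[of _ "(x, y)"])
      then show False using V(2) by blast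
    qed
    ultimately show "\<not> BAD \<Theta> (2/3) (1/3) \<subseteq> (\<Union>j. U j)" by blast
  qed
qed

section \<open>The upper bound: exponents above 2\<close>

text \<open>A grid of N^2 squares of side 1 / N costs at most N^2 (2 / N)^s = 2^s N^(2 - s), which
  tends to 0.\<close>

lemma ex_fine_cover_of_unit_square:
  fixes s \<delta> \<epsilon> :: real and i j :: int
  assumes s: "2 < s" and \<delta>: "0 < \<delta>" and \<epsilon>: "0 < \<epsilon>"
  obtains U :: "nat \<Rightarrow> (real \<times> real) set" where
    "\<And>n. bounded (U n)" "\<And>n. diameter (U n) \<le> \<delta>"
    "{of_int i..<of_int i + 1} \<times> {of_int j..<of_int j + 1} \<subseteq> (\<Union>n. U n)"
    "(\<Sum>n. ennreal (diam_powr s (U n))) \<le> ennreal \<epsilon>"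
proof -
  have "(\<lambda>N. 2 / real N) \<longlonglongrightarrow> 0"
    by (rule lim_const_over_n)
  then have ev1: "eventually (\<lambda>N. 2 / real N < \<delta>) sequentially"
    using \<delta> by (rule order_tendstoD)
  have "(\<lambda>N. 2 powr s * real N powr (2 - s)) \<longlonglongrightarrow> 2 powr s * 0"
    using s by (intro tendsto_mult_left tendsto_neg_powr filterlim_real_sequentially) auto
  then have ev2: "eventually (\<lambda>N. 2 powr s * real N powr (2 - s) < \<epsilon>) sequentially"
    using \<epsilon> by (intro order_tendstoD(2)) auto
  have "eventually (\<lambda>N. 2 / real N < \<delta> \<and> 2 powr s * real N powr (2 - s) < \<epsilon> \<and> 0 < N) sequentially"
    using ev1 ev2 eventually_gt_at_top[of 0] by eventually_elim auto
  then obtain N where N: "2 / real N < \<delta>" "2 powr s * real N powr (2 - s) < \<epsilon>" "0 < N"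
    by (auto simp: eventually_sequentially)
  define Q where "Q = (\<lambda>u v :: nat. {of_int i + real u / real N..of_int i + (real u + 1) / real N} \<times>
      {of_int j + real v / real N..of_int j + (real v + 1) / real N})"
  \<comment> \<open>Row-by-row enumeration of the grid, padded with empty sets, whose
    \<open>diam_powr\<close> is 0.\<close>
  define U where "U = (\<lambda>n. if n < N ^ 2 then Q (n div N) (n mod N) else {})"
  have bdd: "bounded (U n)" for n
    by (auto simp: U_def Q_def intro!: bounded_Times)
  have diam: "diameter (U n) \<le> 2 / real N" for n
  proof (rule diameter_le)
    fix z w assume zw: "z \<in> U n" "w \<in> U n"
    have "norm (z - w) \<le> norm (fst (z - w)) + norm (snd (z - w))"
      using norm_Pair_le[of "fst (z - w)" "snd (z - w)"] by (simp only: prod.collapse)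
    also have "\<dots> \<le> 1 / real N + 1 / real N"
      using zw by (intro add_mono) (auto simp: U_def Q_def add_divide_distrib split: if_splits)
    finally show "norm (z - w) \<le> 2 / real N" by simp
  qed simp
  have cover: "(x, y) \<in> (\<Union>n. U n)"
    if x: "of_int i \<le> x" "x < of_int i + 1" and y: "of_int j \<le> y" "y < of_int j + 1" for x y :: real
  proof -
    have cell: "\<exists>u<N. real u / real N \<le> r \<and> r \<le> (real u + 1) / real N" if r: "0 \<le> r" "r < 1" for r :: real
    proof (intro exI conjI)
      define u where "u = nat \<lfloor>real N * r\<rfloor>"
      have u: "real u \<le> real N * r" "real N * r \<le> real u + 1"
        using r N(3) by (simp_all add: u_def of_nat_nat)
      then show "real u / real N \<le> r" "r \<le> (real u + 1) / real N"
        using N(3) by (simp_all add: field_simps)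
      have "real N * r < real N * 1" using r N(3) by (intro mult_strict_left_mono) auto
      then show "u < N" using u by simp
    qed
    obtain u where u: "u < N" "real u / real N \<le> x - of_int i" "x - of_int i \<le> (real u + 1) / real N"
      using cell[of "x - of_int i"] x by auto
    obtain v where v: "v < N" "real v / real N \<le> y - of_int j" "y - of_int j \<le> (real v + 1) / real N"
      using cell[of "y - of_int j"] y by auto
    have "u * N + v < u * N + N" using v by simp
    also have "\<dots> = Suc u * N" by simp
    also have "\<dots> \<le> N * N" using u by (intro mult_right_mono) auto
    finally have "u * N + v < N ^ 2" by (simp add: power2_eq_square)
    moreover have "(u * N + v) div N = u" "(u * N + v) mod N = v" using v by auto
    ultimately have "(x, y) \<in> U (u * N + v)"
      using u v by (auto simp: U_def Q_def)
    then show ?thesis by blast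
  qed
  have "(\<Sum>n. ennreal (diam_powr s (U n))) = (\<Sum>n<N ^ 2. ennreal (diam_powr s (U n)))"
    by (rule suminf_finite) (auto simp: U_def diam_powr_def)
  also have "\<dots> \<le> (\<Sum>n<N ^ 2. ennreal ((2 / real N) powr s))"
  proof (intro sum_mono ennreal_leI)
    fix n
    have "diameter (U n) powr s \<le> (2 / real N) powr s"
      using s diam[of n] by (intro powr_mono2 diameter_ge_0 bdd) auto
    then show "diam_powr s (U n) \<le> (2 / real N) powr s" using s by (auto simp: diam_powr_def)
  qed
  also have "\<dots> = ennreal (real N ^ 2 * (2 / real N) powr s)"
    by (subst sum_ennreal) auto
  also have "real N ^ 2 * (2 / real N) powr s = 2 powr s * real N powr (2 - s)"
    using N(3) by (simp add: powr_divide powr_diff)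
  also have "ennreal \<dots> \<le> ennreal \<epsilon>" using N(2) by (intro ennreal_leI) simp
  finally have "(\<Sum>n. ennreal (diam_powr s (U n))) \<le> ennreal \<epsilon>" .
  moreover have "diameter (U n) \<le> \<delta>" for n
    using diam[of n] N(1) by linarith
  ultimately show ?thesis using bdd cover by (intro that[of U]) auto
qed

text \<open>Countably many unit squares fill the plane; the k-th is covered at cost \<epsilon> /
  2^(k + 1), and a pairing function merges the covers into one sequence.\<close>

lemma hausdorff_measure_plane_eq_0:
  fixes A :: "(real \<times> real) set"
  assumes s: "2 < s"
  shows "hausdorff_measure s A = 0"
proof -
  have "hausdorff_premeasure s \<delta> A \<le> 0" if \<delta>: "0 < \<delta>" for \<delta>
  proof (rule ennreal_le_epsilon)
    fix \<epsilon> :: real assume \<epsilon>: "0 < \<epsilon>"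
    define e where "e = (\<lambda>k. \<epsilon> * (1/2) ^ Suc k)"
    have e: "0 < e k" for k using \<epsilon> by (simp add: e_def)
    define sq where "sq = (\<lambda>(i, j). {real_of_int i..<of_int i + 1} \<times> {real_of_int j..<of_int j + 1})"
    define idx where "idx = (\<lambda>k. case prod_decode k of (m, n) \<Rightarrow> (int_decode m, int_decode n))"
    have "\<exists>U. (\<forall>n. bounded (U n)) \<and> (\<forall>n. diameter (U n) \<le> \<delta>) \<and> sq (idx k) \<subseteq> (\<Union>n. U n) \<and>
        (\<Sum>n. ennreal (diam_powr s (U n))) \<le> ennreal (e k)" for k
      using ex_fine_cover_of_unit_square[OF s \<delta> e, of "fst (idx k)" "snd (idx k)" k]
      unfolding sq_def case_prod_beta by metis
    then obtain U where U: "\<And>k n. bounded (U k n)" "\<And>k n. diameter (U k n) \<le> \<delta>"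
      "\<And>k. sq (idx k) \<subseteq> (\<Union>n. U k n)" "\<And>k. (\<Sum>n. ennreal (diam_powr s (U k n))) \<le> ennreal (e k)"
      by metis
    define W where "W = (\<lambda>n. case prod_decode n of (k, l) \<Rightarrow> U k l)"
    have "A \<subseteq> (\<Union>n. W n)"
    proof
      fix z assume "z \<in> A"
      obtain x y where z: "z = (x, y)" by (cases z)
      define k where "k = prod_encode (int_encode \<lfloor>x\<rfloor>, int_encode \<lfloor>y\<rfloor>)"
      have "z \<in> sq (idx k)" by (simp add: z sq_def idx_def k_def)
      then obtain l where "z \<in> U k l" using U(3) by blast
      then have "z \<in> W (prod_encode (k, l))" by (simp add: W_def)
      then show "z \<in> (\<Union>n. W n)" by blast
    qed
    then have "hausdorff_premeasure s \<delta> A \<le> (\<Sum>n. ennreal (diam_powr s (W n)))"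
      unfolding hausdorff_premeasure_def
      by (intro INF_lower) (auto simp: W_def U split: prod.split)
    also have "\<dots> = (\<Sum>n. (\<lambda>(k, l). ennreal (diam_powr s (U k l))) (prod_decode n))"
      by (simp add: W_def case_prod_beta)
    also have "\<dots> = (\<Sum>k. \<Sum>l. ennreal (diam_powr s (U k l)))"
      by (rule suminf_ennreal_2dimen) simp
    also have "\<dots> \<le> (\<Sum>k. ennreal (e k))" by (intro suminf_le U) auto
    also have "\<dots> = ennreal \<epsilon>"
    proof -
      have "e sums \<epsilon>" unfolding e_def using sums_mult[OF power_half_series, of \<epsilon>] by simp
      then show ?thesis using e by (intro suminf_ennreal_eq) (auto simp: less_imp_le)
    qed
    finally show "hausdorff_premeasure s \<delta> A \<le> 0 + ennreal \<epsilon>" by simp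
  qed
  then have "hausdorff_measure s A \<le> 0"
    unfolding hausdorff_measure_def by (intro SUP_least) auto
  then show ?thesis by simp
qed

section \<open>Hausdorff dimension 2\<close>

lemma hausdorff_measure_BAD_neq_0:
  assumes s: "0 \<le> s" "s < 2"
  shows "hausdorff_measure s (BAD \<Theta> (2/3) (1/3)) \<noteq> 0"
proof
  let ?B = "BAD \<Theta> (2/3) (1/3)"
  assume zero: "hausdorff_measure s ?B = 0"
  \<comment> \<open>\<open>BAD_not_covered\<close> asks for an exponent in [1, 2); the midpoint of
    \<open>s\<close> and 2 is one, and it is at least \<open>s\<close>.\<close>
  define r where "r = (s + 2) / 2"
  have r: "1 \<le> r" "r < 2" "s \<le> r" using s by (auto simp: r_def)
  obtain c :: real where c: "0 < c" and notcov:
    "\<And>U :: nat \<Rightarrow> (real \<times> real) set. \<lbrakk>\<And>j. bounded (U j); \<And>j. diameter (U j) \<le> 1;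
       (\<Sum>j. ennreal (diameter (U j) powr r)) < ennreal c\<rbrakk> \<Longrightarrow> \<not> ?B \<subseteq> (\<Union>j. U j)"
    by (rule BAD_not_covered[OF r(1,2), where \<Theta> = \<Theta>]) (rule that; blast)
  have "hausdorff_premeasure s 1 ?B \<le> hausdorff_measure s ?B"
    unfolding hausdorff_measure_def by (intro SUP_upper) auto
  then have "hausdorff_premeasure s 1 ?B < ennreal c" using zero c by simp
  then obtain U :: "nat \<Rightarrow> (real \<times> real) set" where U: "\<And>n. bounded (U n)" "\<And>n. diameter (U n) \<le> 1"
    "?B \<subseteq> (\<Union>n. U n)" and sum: "(\<Sum>n. ennreal (diam_powr s (U n))) < ennreal c"
    unfolding hausdorff_premeasure_def INF_less_iff by blast
  \<comment> \<open>Diameters are at most 1, so raising the exponent lowers the power. The bound by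
    1 serves s = 0, where every non-empty set costs 1.\<close>
  have "diameter (U n) powr r \<le> diam_powr s (U n)" for n
  proof -
    have "0 \<le> diameter (U n)" using U(1) by (rule diameter_ge_0)
    then have "diameter (U n) powr r \<le> diameter (U n) powr s" "diameter (U n) powr r \<le> 1"
      using r U(2)[of n] by (auto intro!: powr_mono' powr_le1)
    then show ?thesis using r by (auto simp: diam_powr_def)
  qed
  then have "(\<Sum>n. ennreal (diameter (U n) powr r)) \<le> (\<Sum>n. ennreal (diam_powr s (U n)))"
    by (intro suminf_le ennreal_leI) auto
  then have "(\<Sum>n. ennreal (diameter (U n) powr r)) < ennreal c" using sum by (rule le_less_trans)
  with notcov[of U] U show False by blast
qed

theorem mainTheorem1:
  fixes \<Theta> :: "real \<times> real"
  shows "BAD \<Theta> (2/3) (1/3) \<noteq> {} \<and> hausdorff_dim (BAD \<Theta> (2/3) (1/3)) = 2"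
proof
  let ?B = "BAD \<Theta> (2/3) (1/3)"
  have "1 \<le> (1::real)" "1 < (2::real)" by auto
  then obtain c :: real where c: "0 < c" and notcov:
    "\<And>U :: nat \<Rightarrow> (real \<times> real) set. \<lbrakk>\<And>j. bounded (U j); \<And>j. diameter (U j) \<le> 1;
       (\<Sum>j. ennreal (diameter (U j) powr 1)) < ennreal c\<rbrakk> \<Longrightarrow> \<not> ?B \<subseteq> (\<Union>j. U j)"
    by (rule BAD_not_covered[where \<Theta> = \<Theta>]) (rule that; blast)
  \<comment> \<open>The cover by empty sets costs 0 < c, so it cannot contain the set.\<close>
  show "?B \<noteq> {}" using notcov[of "\<lambda>_. {}"] c by auto
  have "2 \<le> hausdorff_dim ?B"
    unfolding hausdorff_dim_def
  proof (rule INF_greatest)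
    fix s assume "s \<in> {s. 0 \<le> s \<and> hausdorff_measure s ?B = 0}"
    then have "2 \<le> s" using hausdorff_measure_BAD_neq_0[of s \<Theta>] by force
    then have "ennreal 2 \<le> ennreal s" by (rule ennreal_leI)
    then show "2 \<le> ennreal s" by simp
  qed
  moreover have "hausdorff_dim ?B \<le> 2"
  proof (rule ennreal_le_epsilon)
    fix \<epsilon> :: real assume \<epsilon>: "0 < \<epsilon>"
    have "hausdorff_dim ?B \<le> ennreal (2 + \<epsilon>)"
      unfolding hausdorff_dim_def
      by (rule INF_lower) (use \<epsilon> in \<open>simp add: hausdorff_measure_plane_eq_0\<close>)
    then show "hausdorff_dim ?B \<le> 2 + ennreal \<epsilon>" using \<epsilon> by simp
  qed
  ultimately show "hausdorff_dim ?B = 2" by (rule antisym[rotated])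
qed

end
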